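(* Let $n,c$ be positive integers and $k=c\cdot n$. Then $F(k,n)=c+n-1$.
   Context: Clear Mastermind with $n\ge 1$ positions and $k\ge 1$ codes: write $[k]=\{1,\dots,k\}$. A codemaker fixes a secret answer $y=(y_1,\dots,y_n)\in[k]^n$. In each round the codebreaker submits a guess $x\in[k]^n$ (any string, chosen adaptively from previous guesses and feedback) and receives feedback $\pi(x,y)\in\{\mathrm{G},\mathrm{Y},\mathrm{B}\}^n$ defined as follows: for every position $i$ with $x_i=y_i$, $\pi_i=\mathrm{G}$. Let $M$ be the multiset $\{y_i : x_i\ne y_i\}$ of answer codes at non-G positions. Then scan the non-G positions $j$ in increasing order: if $x_j$ currently occurs in $M$, set $\pi_j=\mathrm{Y}$ and remove one copy of $x_j$ from $M$; otherwise set $\pi_j=\mathrm{B}$. The codebreaker finds the answer in $m$ rounds if her $m$-th guess equals $y$. $F(k,n)$ is the least $m$ such that the codebreaker has a strategy that, for every answer $y\in[k]^n$, makes a guess equal to $y$ within the first $m$ rounds. *)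

theory Defs
  imports Main "HOL-Library.Multiset"
begin

definition codes :: "nat \<Rightarrow> nat \<Rightarrow> nat list set" where
  "codes k n = {x. length x = n \<and> set x \<subseteq> {1..k}}"

datatype mark = Green | Yellow | Black

text \<open>Scanning the list of pairs (guess entry, answer entry) from left to right; the multiset
  holds the answer codes at non-green positions that have not been used up by a yellow mark.\<close>

fun marks :: "nat multiset \<Rightarrow> (nat \<times> nat) list \<Rightarrow> mark list" where
  "marks M [] = []"
| "marks M ((a, b) # ps) =
     (if a = b then Green # marks M ps
      else if a \<in># M then Yellow # marks (M - {#a#}) ps
      else Black # marks M ps)"

definition feedback :: "nat list \<Rightarrow> nat list \<Rightarrow> mark list" where
  "feedback x y =
     marks (mset (map snd (filter (\<lambda>(a, b). a \<noteq> b) (zip x y)))) (zip x y)"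

text \<open>A strategy maps the list of earlier guesses with their feedback, oldest first, to the
  next guess.\<close>

type_synonym strategy = "(nat list \<times> mark list) list \<Rightarrow> nat list"

primrec history :: "strategy \<Rightarrow> nat list \<Rightarrow> nat \<Rightarrow> (nat list \<times> mark list) list" where
  "history s y 0 = []"
| "history s y (Suc m) =
     (let h = history s y m; x = s h in h @ [(x, feedback x y)])"

definition guess :: "strategy \<Rightarrow> nat list \<Rightarrow> nat \<Rightarrow> nat list" where
  "guess s y i = s (history s y i)"

text \<open>Rounds are counted from \<open>0\<close> in \<^const>\<open>guess\<close>, so the first \<open>m\<close> rounds are those
  with index \<open>i < m\<close>.\<close>

definition solves_within :: "nat \<Rightarrow> nat \<Rightarrow> nat \<Rightarrow> strategy \<Rightarrow> bool" where
  "solves_within k n m s \<longleftrightarrow>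
     (\<forall>h. s h \<in> codes k n) \<and> (\<forall>y\<in>codes k n. \<exists>i<m. guess s y i = y)"

definition F :: "nat \<Rightarrow> nat \<Rightarrow> nat" where
  "F k n = (LEAST m. \<exists>s. solves_within k n m s)"

text \<open>The set minimised over in \<^const>\<open>F\<close> is nonempty, as one may guess all codes in turn.\<close>

lemma ex_solves_within:
  assumes "k > 0"
  shows "\<exists>m s. solves_within k n m s"
proof -
  have "finite (codes k n)"
    using finite_lists_length_eq[of "{1..k}" n] by (simp add: codes_def conj_commute)
  then obtain xs where xs: "set xs = codes k n"
    using finite_list by blast
  have "replicate n 1 \<in> codes k n"
    using assms by (auto simp: codes_def)
  then have ne: "xs \<noteq> []"
    using xs by auto
  define s :: strategy where "s h = xs ! (length h mod length xs)" for h
  have len: "length (history s y i) = i" for y i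
    by (induction i) (simp_all add: Let_def)
  have "s h \<in> codes k n" for h
    unfolding xs[symmetric] s_def using ne by (intro nth_mem) simp
  moreover have "\<exists>i<length xs. guess s y i = y" if "y \<in> codes k n" for y
    using that unfolding xs[symmetric] by (auto simp: in_set_conv_nth guess_def s_def len)
  ultimately have "solves_within k n (length xs) s"
    by (simp add: solves_within_def)
  then show ?thesis by blast
qed

end

theory Submission
  imports Defs
begin

text \<open>
  Upper bound: \<open>c\<close> guesses with pairwise distinct entries, together using every code once, reveal
  which codes occur. If fewer than \<open>n\<close> codes occur, or one of them was marked green,
  constant guesses finish in \<open>n - 1\<close> rounds. Otherwise the answer is a permutation of \<open>n\<close> known
  codes with a known pair \<open>(a, i)\<close> such that \<open>a\<close> is not at position \<open>i\<close>. Guessing another code \<open>b\<close>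
  at \<open>i\<close> and \<open>a\<close> elsewhere locates \<open>a\<close>, and either locates \<open>b\<close> too or yields the new pair
  \<open>(b, i)\<close>; this saves the missing round.

  Lower bound: the first \<open>c - 1\<close> guesses are marked all black, which leaves \<open>n\<close> unused codes. From
  then on the answers are permutations of these codes. The adversary keeps a set \<open>P\<close> of undecided
  positions, each with a set of codes still possible there, and loses at most one possible code per
  position and round: among the admissible permutations she takes one with as few green marks as
  possible, and keeps only those positions from which no green position is reachable by exchanging
  codes. If there were none, exchanging codes along a cycle through a green position
  would yield fewer green marks.
\<close>

section \<open>The game as a recursion on the set of answers still possible\<close>

text \<open>A strategy-free form of the game: \<open>A\<close> holds the unfound answers consistent
  with the feedback so far and \<open>r\<close> is the number of rounds left. A correctly guessed
  answer leaves \<open>A\<close>, so winning means that nothing remains at the end.\<close>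

primrec winnable :: "nat \<Rightarrow> nat \<Rightarrow> nat \<Rightarrow> nat list set \<Rightarrow> bool" where
  "winnable k n 0 A \<longleftrightarrow> A = {}"
| "winnable k n (Suc r) A \<longleftrightarrow>
     (\<exists>x\<in>codes k n. \<forall>f. winnable k n r {y \<in> A. feedback x y = f \<and> y \<noteq> x})"

text \<open>Histories grow at their end, whereas \<open>winnable\<close> recurses on the first
  guess. The first record is absorbed into the strategy instead.\<close>

lemma history_Suc_Cons:
  "history s y (Suc m) =
     (s [], feedback (s []) y) # history (\<lambda>h. s ((s [], feedback (s []) y) # h)) y m"
  by (induction m) (simp_all add: Let_def)

lemma guess_0: "guess s y 0 = s []"
  by (simp add: guess_def)

lemma guess_Suc:
  "guess s y (Suc i) = guess (\<lambda>h. s ((s [], feedback (s []) y) # h)) y i"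
  by (simp only: guess_def history_Suc_Cons)

lemma winnable_if_strategy:
  assumes "\<forall>h. s h \<in> codes k n" "\<forall>y\<in>A. \<exists>i<m. guess s y i = y"
  shows "winnable k n m A"
  using assms
proof (induction m arbitrary: s A)
  case 0
  then show ?case by auto
next
  case (Suc m)
  have "winnable k n m {y \<in> A. feedback (s []) y = f \<and> y \<noteq> s []}" for f
  proof (rule Suc.IH[of "\<lambda>h. s ((s [], f) # h)"])
    show "\<forall>h. s ((s [], f) # h) \<in> codes k n"
      using Suc.prems by blast
    show "\<forall>y\<in>{y \<in> A. feedback (s []) y = f \<and> y \<noteq> s []}.
        \<exists>i<m. guess (\<lambda>h. s ((s [], f) # h)) y i = y"
    proof
      fix y assume y: "y \<in> {y \<in> A. feedback (s []) y = f \<and> y \<noteq> s []}"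
      then obtain i where i: "i < Suc m" "guess s y i = y"
        using Suc.prems(2) by blast
      \<comment> \<open>Round 0 guesses \<open>s []\<close>, which \<open>y\<close> is assumed to
        differ from.\<close>
      with y obtain i' where "i = Suc i'"
        by (cases i) (auto simp: guess_0)
      with i y show "\<exists>i<m. guess (\<lambda>h. s ((s [], f) # h)) y i = y"
        by (auto simp: guess_Suc)
    qed
  qed
  then show ?case
    using Suc.prems(1) by auto
qed

lemma strategy_if_winnable:
  assumes "k > 0" "winnable k n m A"
  shows "\<exists>s. (\<forall>h. s h \<in> codes k n) \<and> (\<forall>y\<in>A. \<exists>i<m. guess s y i = y)"
  using assms(2)
proof (induction m arbitrary: A)
  case 0
  have "replicate n 1 \<in> codes k n"
    using assms(1) by (auto simp: codes_def)
  with 0 show ?case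
    by (intro exI[of _ "\<lambda>_. replicate n 1"]) auto
next
  case (Suc m)
  then obtain x where x: "x \<in> codes k n"
    "\<And>f. winnable k n m {y \<in> A. feedback x y = f \<and> y \<noteq> x}"
    by auto
  \<comment> \<open>One continuation per feedback; the combined strategy selects among them by the
    feedback of its first guess.\<close>
  have "\<forall>f. \<exists>s. (\<forall>h. s h \<in> codes k n) \<and>
      (\<forall>y\<in>{y \<in> A. feedback x y = f \<and> y \<noteq> x}. \<exists>i<m. guess s y i = y)"
    using Suc.IH x(2) by blast
  from choice[OF this] obtain t where "\<forall>f. (\<forall>h. t f h \<in> codes k n) \<and>
      (\<forall>y\<in>{y \<in> A. feedback x y = f \<and> y \<noteq> x}. \<exists>i<m. guess (t f) y i = y)" ..
  then have t: "\<And>f h. t f h \<in> codes k n"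
    "\<And>f y. y \<in> A \<Longrightarrow> feedback x y = f \<Longrightarrow> y \<noteq> x \<Longrightarrow> \<exists>i<m. guess (t f) y i = y"
    by auto
  define s :: strategy where
    "s h = (case h of [] \<Rightarrow> x | p # h' \<Rightarrow> t (snd p) h')" for h
  have s_simps: "s [] = x" "s (p # h) = t (snd p) h" for p h
    by (simp_all add: s_def)
  have "s h \<in> codes k n" for h
    by (cases h) (simp_all add: s_simps x t)
  moreover have "\<exists>i<Suc m. guess s y i = y" if y: "y \<in> A" for y
  proof (cases "y = x")
    case True
    then show ?thesis by (intro exI[of _ 0]) (simp add: guess_0 s_simps)
  next
    case False
    then obtain i where "i < m" "guess (t (feedback x y)) y i = y"
      using t(2) y by blast
    then show ?thesis
      by (intro exI[of _ "Suc i"]) (simp add: guess_Suc s_simps)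
  qed
  ultimately show ?case by blast
qed

lemma ex_solves_within_iff:
  assumes "k > 0"
  shows "(\<exists>s. solves_within k n m s) \<longleftrightarrow> winnable k n m (codes k n)"
  using strategy_if_winnable[OF assms, of n m] winnable_if_strategy
  unfolding solves_within_def by blast

lemma winnable_empty: "k > 0 \<Longrightarrow> winnable k n r {}"
proof (induction r)
  case (Suc r)
  have "replicate n 1 \<in> codes k n"
    using Suc.prems by (auto simp: codes_def)
  with Suc show ?case by auto
qed simp

lemma winnable_singleton:
  assumes "k > 0" "x \<in> codes k n" "r > 0" "A \<subseteq> {x}"
  shows "winnable k n r A"
proof -
  obtain r' where r: "r = Suc r'"
    using assms(3) by (cases r) auto
  have "winnable k n r' {y \<in> A. feedback x y = f \<and> y \<noteq> x}" for f
  proof -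
    have "{y \<in> A. feedback x y = f \<and> y \<noteq> x} = {}"
      using assms(4) by auto
    then show ?thesis
      using winnable_empty[OF assms(1)] by metis
  qed
  then show ?thesis
    using assms(2) unfolding r by auto
qed

section \<open>What the feedback reveals and what it depends on\<close>

lemma length_marks [simp]: "length (marks M ps) = length ps"
  by (induction M ps rule: marks.induct) auto

lemma marks_nth_Green_iff:
  "i < length ps \<Longrightarrow> marks M ps ! i = Green \<longleftrightarrow> fst (ps ! i) = snd (ps ! i)"
  by (induction M ps arbitrary: i rule: marks.induct) (auto simp: nth_Cons split: nat.splits)

text \<open>With distinct guess entries, removing a yellow code from \<open>M\<close> cannot affect
  any later position, so the initial multiset decides.\<close>

lemma marks_nth_Black_iff:
  assumes "distinct (map fst ps)" "i < length ps"
  shows "marks M ps ! i = Black \<longleftrightarrow> fst (ps ! i) \<noteq> snd (ps ! i) \<and> fst (ps ! i) \<notin># M"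
  using assms
proof (induction M ps arbitrary: i rule: marks.induct)
  case (2 M a b ps)
  have "fst (ps ! j) \<noteq> a" if "j < length ps" for j
    using 2(4) that by (metis distinct.simps(2) fst_conv length_map list.simps(9) nth_map nth_mem)
  then show ?case
    using 2 by (cases i) (auto simp: in_diff_count)
qed simp

text \<open>Once \<open>M\<close> is fixed, the scan uses the answer only to test for green.\<close>

lemma marks_cong:
  assumes "map fst ps = map fst qs"
    and "map (\<lambda>p. fst p = snd p) ps = map (\<lambda>p. fst p = snd p) qs"
  shows "marks M ps = marks M qs"
  using assms
proof (induction M ps arbitrary: qs rule: marks.induct)
  case (2 M a b ps)
  then obtain b' qs' where "qs = (a, b') # qs'"
    by (cases qs) auto
  with 2 show ?case by auto
qed simp

lemma feedback_nth_Green_iff: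
  assumes "length x = n" "length y = n" "i < n"
  shows "feedback x y ! i = Green \<longleftrightarrow> x ! i = y ! i"
  using assms by (simp add: feedback_def marks_nth_Green_iff)

lemma feedback_eq_greens:
  assumes "feedback x y = feedback x z" "length x = n" "length y = n" "length z = n" "i < n"
  shows "y ! i = x ! i \<longleftrightarrow> z ! i = x ! i"
  using feedback_nth_Green_iff[OF assms(2,3,5)] feedback_nth_Green_iff[OF assms(2,4,5)]
  unfolding assms(1) by metis

lemma feedback_nth_Black_iff:
  assumes "length x = n" "length y = n" "i < n" "distinct x"
  shows "feedback x y ! i = Black \<longleftrightarrow> x ! i \<notin> set y"
proof -
  have "x ! i = y ! i \<or> x ! i \<in> snd ` {p \<in> set (zip x y). fst p \<noteq> snd p}
      \<longleftrightarrow> x ! i \<in> set y" (is "?L \<longleftrightarrow> ?R")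
  proof
    assume ?L
    then show ?R
      using assms(2,3) by (auto dest: set_zip_rightD)
  next
    assume ?R
    then obtain j where j: "j < n" "y ! j = x ! i"
      using assms(2) by (metis in_set_conv_nth)
    show ?L
    \<comment> \<open>If \<open>j\<close> differs from \<open>i\<close>, distinctness of
      \<open>x\<close> keeps position \<open>j\<close> from being green, so its code enters the
      multiset.\<close>
    proof (cases "j = i")
      case False
      then have "x ! j \<noteq> y ! j"
        using assms j by (simp add: nth_eq_iff_index_eq)
      moreover have "(x ! j, y ! j) \<in> set (zip x y)"
        using j assms by (auto simp: in_set_zip)
      ultimately have "(x ! j, y ! j) \<in> {p \<in> set (zip x y). fst p \<noteq> snd p}" by simp
      then have "snd (x ! j, y ! j) \<in> snd ` {p \<in> set (zip x y). fst p \<noteq> snd p}"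
        by (rule imageI)
      then show ?thesis using j by simp
    qed (use j in simp)
  qed
  then show ?thesis
    using assms unfolding feedback_def
    by (subst marks_nth_Black_iff) (auto simp: case_prod_beta)
qed

lemma feedback_disjoint:
  assumes "length x = n" "length y = n" "set x \<inter> set y = {}"
  shows "feedback x y = replicate n Black"
proof -
  have "marks M ps = replicate (length ps) Black"
    if "fst ` set ps \<inter> (snd ` set ps \<union> set_mset M) = {}" for M ps
    using that by (induction M ps rule: marks.induct) auto
  from this[of "zip x y" "mset (map snd (filter (\<lambda>(a, b). a \<noteq> b) (zip x y)))"]
  show ?thesis
    using assms by (fastforce simp: feedback_def dest: set_zip_leftD set_zip_rightD)
qed

text \<open>Green codes can be read off the guess, which is why the second part uses
  \<open>fst\<close>: the non-green multiset is then determined by \<open>mset y\<close>, the guess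
  and the green positions.\<close>

lemma mset_nongreen:
  "length x = length y \<Longrightarrow>
   mset y = mset (map snd (filter (\<lambda>(a, b). a \<noteq> b) (zip x y)))
          + mset (map fst (filter (\<lambda>(a, b). a = b) (zip x y)))"
  by (induction x y rule: list_induct2) auto

lemma map_filter_zip_greens:
  assumes "length x = length y" "length x = length z"
    and "\<forall>i<length x. x ! i = y ! i \<longleftrightarrow> x ! i = z ! i"
  shows "map fst (filter (\<lambda>(a, b). a = b) (zip x y)) =
         map fst (filter (\<lambda>(a, b). a = b) (zip x z))"
  using assms
proof (induction x y arbitrary: z rule: list_induct2)
  case (Cons a x b y)
  then obtain d z' where z: "z = d # z'" by (cases z) auto
  have "a = b \<longleftrightarrow> a = d" "\<forall>i<length x. x ! i = y ! i \<longleftrightarrow> x ! i = z' ! i"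
    using Cons.prems(2) unfolding z by auto
  with Cons z show ?case by auto
qed simp

text \<open>The adversary's basic tool: rearranging an answer without changing its green positions
  is invisible to the codebreaker.\<close>

lemma feedback_cong:
  assumes "length x = n" "length y = n" "length z = n" "mset y = mset z"
    and "\<forall>i<n. x ! i = y ! i \<longleftrightarrow> x ! i = z ! i"
  shows "feedback x y = feedback x z"
proof -
  have "mset (map snd (filter (\<lambda>(a, b). a \<noteq> b) (zip x y))) =
        mset (map snd (filter (\<lambda>(a, b). a \<noteq> b) (zip x z)))"
    using mset_nongreen[of x y] mset_nongreen[of x z] map_filter_zip_greens[of x y z] assms
    by simp
  moreover have "map (\<lambda>p. fst p = snd p) (zip x y) = map (\<lambda>p. fst p = snd p) (zip x z)"
    using assms by (intro nth_equalityI) auto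
  moreover have "map fst (zip x y) = map fst (zip x z)"
    using assms by simp
  ultimately show ?thesis
    unfolding feedback_def by (simp only: marks_cong[of "zip x y" "zip x z"])
qed

section \<open>Upper bound\<close>

text \<open>A constant guess locates all occurrences of one code of \<open>E\<close>. Once at most
  one code is left, the answer is determined, so the last round can name it; hence
  \<open>card E\<close> rounds suffice if positive.\<close>

lemma winnable_constant_guesses:
  assumes "k > 0" "A \<subseteq> codes k n" "P \<subseteq> {..<n}" "E \<subseteq> {1..k}" "card E \<le> r" "r > 0"
    and "\<forall>y\<in>A. \<forall>i\<in>P. y ! i \<in> E"
    and "\<forall>y\<in>A. \<forall>z\<in>A. \<forall>i\<in>{..<n} - P. y ! i = z ! i"
  shows "winnable k n r A"
  using assms(2-8)
proof (induction r arbitrary: A P E)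
  case 0
  then show ?case by blast
next
  case (Suc r)
  have fin: "finite E"
    using Suc.prems(3) finite_subset by blast
  show ?case
  proof (cases "r = 0")
    case True
    show ?thesis
    proof (cases "A = {}")
      case True
      then show ?thesis using winnable_empty[OF assms(1)] by blast
    next
      case False
      then obtain y where y: "y \<in> A" by auto
      have E: "a = b" if "a \<in> E" "b \<in> E" for a b
        using card_le_Suc0_iff_eq[OF fin] Suc.prems(4) True that by auto
      have "z = y" if z: "z \<in> A" for z
      proof (rule nth_equalityI)
        show len: "length z = length y"
          using y z Suc.prems(1) by (auto simp: codes_def)
        fix i assume "i < length z"
        then have "i < n"
          using z Suc.prems(1) by (auto simp: codes_def)
        then show "z ! i = y ! i"
        proof (cases "i \<in> P")
          case True
          then show ?thesis using E Suc.prems(6) y z by blast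
        next
          case False
          with \<open>i < n\<close> have "i \<in> {..<n} - P" by simp
          then show ?thesis using Suc.prems(7) y z by blast
        qed
      qed
      then show ?thesis
        using y Suc.prems(1) by (intro winnable_singleton[OF assms(1), of y]) blast+
    qed
  next
    case False
    \<comment> \<open>For empty \<open>E\<close> the code 1 is an arbitrary legal guess that merely
      spends a round.\<close>
    obtain a where a: "a \<in> {1..k}" "card (E - {a}) \<le> r"
    proof (cases "E = {}")
      case True
      then show ?thesis using that[of 1] assms(1) by auto
    next
      case False
      then obtain a where "a \<in> E" by auto
      then show ?thesis using that[of a] Suc.prems(3,4) fin by auto
    qed
    define x where "x = replicate n a"
    have x: "x \<in> codes k n" "length x = n"
      using a by (auto simp: x_def codes_def)
    have "winnable k n r {y \<in> A. feedback x y = f \<and> y \<noteq> x}" (is "winnable k n r ?A") for f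
    proof (rule Suc.IH)
      \<comment> \<open>Green positions are now known to carry \<open>a\<close> and join the settled
        ones.\<close>
      let ?P = "{i \<in> P. f ! i \<noteq> Green}"
      have green: "f ! i = Green \<longleftrightarrow> y ! i = a" if "y \<in> ?A" "i < n" for y i
      proof -
        have "length y = n" using that Suc.prems(1) by (auto simp: codes_def)
        from feedback_nth_Green_iff[OF x(2) this that(2)] that show ?thesis
          by (auto simp: x_def)
      qed
      show "?A \<subseteq> codes k n" "?P \<subseteq> {..<n}" "E - {a} \<subseteq> {1..k}"
        using Suc.prems(1-3) by auto
      show "card (E - {a}) \<le> r" "0 < r" using a False by auto
      show "\<forall>y\<in>?A. \<forall>i\<in>?P. y ! i \<in> E - {a}"
        using green Suc.prems(2,6) by fastforce
      show "\<forall>y\<in>?A. \<forall>z\<in>?A. \<forall>i\<in>{..<n} - ?P. y ! i = z ! i"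
      proof (intro ballI)
        fix y z i assume yz: "y \<in> ?A" "z \<in> ?A" and i: "i \<in> {..<n} - ?P"
        show "y ! i = z ! i"
        proof (cases "i \<in> P")
          case True
          then show ?thesis using green[OF yz(1), of i] green[OF yz(2), of i] i by auto
        next
          case False
          with i have "i \<in> {..<n} - P" by simp
          then show ?thesis using Suc.prems(7) yz by blast
        qed
      qed
    qed
    then show ?thesis using x(1) by auto
  qed
qed

text \<open>The \<open>Suc r\<close> codes of \<open>E\<close> fill \<open>P\<close> bijectively,
  and constant guesses would take \<open>Suc r\<close> rounds; the excluded pair
  \<open>(a, i)\<close> saves one. It lets position \<open>i\<close> test a second code while the
  other positions still locate \<open>a\<close>.\<close>

lemma winnable_excluded_pair:
  assumes "k > 0" "A \<subseteq> codes k n" "P \<subseteq> {..<n}" "E \<subseteq> {1..k}" "card P = Suc r" "card E = Suc r"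
    and "r > 0" "a \<in> E" "i \<in> P"
    and "\<forall>y\<in>A. (!) y ` P = E \<and> y ! i \<noteq> a"
    and "\<forall>y\<in>A. \<forall>z\<in>A. \<forall>j\<in>{..<n} - P. y ! j = z ! j"
  shows "winnable k n r A"
  using assms(2-11)
proof (induction r arbitrary: A P E a i)
  case 0
  then show ?case by blast
next
  case (Suc r)
  have fin: "finite E" "finite P"
    using Suc.prems(2,3) finite_subset by blast+
  have inj: "inj_on ((!) y) P" if "y \<in> A" for y
    using eq_card_imp_inj_on[OF fin(2)] Suc.prems(4,5,9) that by metis
  have i: "i < n" using Suc.prems(2,8) by auto
  show ?case
  proof (cases "r = 0")
    \<comment> \<open>Two codes on two positions with one placement excluded: only one answer is
      left.\<close>
    case True
    have "card (P - {i}) = 1" "card (E - {a}) = 1"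
      using Suc.prems(4,5,7,8) True fin by simp_all
    then obtain q b where qb: "P - {i} = {q}" "E - {a} = {b}"
      by (auto simp: card_1_singleton_iff)
    have yy: "y ! i = b \<and> y ! q = a" if "y \<in> A" for y
    proof -
      have P: "P = {i, q}" and E: "E = {a, b}" using qb Suc.prems(7,8) by auto
      have "{y ! i, y ! q} = {a, b}" "y ! i \<noteq> a"
        using Suc.prems(9) that unfolding P E by auto
      then show ?thesis by (auto simp: doubleton_eq_iff)
    qed
    have eq: "\<forall>y\<in>A. \<forall>z\<in>A. \<forall>j\<in>{..<n} - {}. y ! j = z ! j"
    proof (intro ballI)
      fix y z j assume *: "y \<in> A" "z \<in> A" "j \<in> {..<n} - {}"
      show "y ! j = z ! j"
      proof (cases "j \<in> P")
        case True
        then have "j = i \<or> j = q" using qb(1) by blast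
        then show ?thesis using yy[OF *(1)] yy[OF *(2)] by metis
      next
        case False
        then show ?thesis using * Suc.prems(10) by blast
      qed
    qed
    show ?thesis
      by (rule winnable_constant_guesses[OF assms(1) Suc.prems(1) _ _ _ _ _ eq, of "{}"]) simp_all
  next
    case False
    have "card (E - {a}) \<noteq> 0"
      using Suc.prems(5,7) fin by simp
    then have "E - {a} \<noteq> {}" by (metis card.empty)
    then obtain b where b: "b \<in> E" "b \<noteq> a" by auto
    define x where "x = (replicate n a)[i := b]"
    have "set x \<subseteq> insert b {a}"
      unfolding x_def by (rule order.trans[OF set_update_subset_insert]) auto
    then have x: "x \<in> codes k n" "length x = n"
      using b Suc.prems(3,7) by (auto simp: x_def codes_def)
    have "winnable k n r {y \<in> A. feedback x y = f \<and> y \<noteq> x}" (is "winnable k n r ?A") for f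
    proof (cases "?A = {}")
      case True
      then show ?thesis using winnable_empty[OF assms(1)] by metis
    next
      case ne: False
      \<comment> \<open>A representative: all answers left after this feedback share its green
        positions, in particular the position \<open>q\<close> of \<open>a\<close>.\<close>
      then obtain y0 where y0: "y0 \<in> ?A" by blast
      have same: "y ! j = x ! j \<longleftrightarrow> y0 ! j = x ! j" if "y \<in> ?A" "j < n" for y j
      proof (rule feedback_eq_greens[OF _ x(2) _ _ that(2)])
        show "feedback x y = feedback x y0" using that(1) y0 by simp
        show "length y = n" "length y0 = n"
          using that(1) y0 Suc.prems(1) unfolding codes_def by blast+
      qed
      have yP: "(!) y ` P = E" "y ! i \<noteq> a" if "y \<in> ?A" for y
        using Suc.prems(9) that by blast+
      have off: "y ! j = z ! j" if "y \<in> ?A" "z \<in> ?A" "j < n" "j \<notin> P" for y z j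
        using Suc.prems(10) that by blast
      obtain q where q: "q \<in> P" "y0 ! q = a"
        using yP(1)[OF y0] Suc.prems(7) by blast
      have qi: "q \<noteq> i" using q yP(2)[OF y0] by metis
      have qn: "q < n" using q Suc.prems(2) by auto
      have yq: "y ! q = a" if "y \<in> ?A" for y
        using same[OF that qn] q qi qn by (simp add: x_def)
      have img: "(!) y ` (P - {q}) = E - {a}" if "y \<in> ?A" for y
      proof -
        have "(!) y ` (P - {q}) = (!) y ` P - (!) y ` {q}"
          using inj[of y] that q(1) by (intro inj_on_image_set_diff[where C = P]) blast+
        also have "(!) y ` P = E" using yP(1)[OF that] .
        finally show ?thesis using yq[OF that] by simp
      qed
      show ?thesis
      proof (cases "y0 ! i = b")
        \<comment> \<open>One guess located both \<open>a\<close> and \<open>b\<close>, so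
          \<open>r\<close> codes and \<open>r\<close> rounds are left.\<close>
        case True
        have yi: "y ! i = b" if "y \<in> ?A" for y
          using same[OF that i] True i by (simp add: x_def)
        have img2: "(!) y ` (P - {q} - {i}) = E - {a} - {b}" if "y \<in> ?A" for y
        proof -
          have "(!) y ` (P - {q} - {i}) = (!) y ` (P - {q}) - (!) y ` {i}"
            using inj[of y] that qi Suc.prems(8) by (intro inj_on_image_set_diff[where C = P]) blast+
          then show ?thesis using img[OF that] yi[OF that] by simp
        qed
        show ?thesis
        proof (rule winnable_constant_guesses[OF assms(1), of _ _ "P - {q} - {i}" "E - {a} - {b}"])
          show "?A \<subseteq> codes k n" "P - {q} - {i} \<subseteq> {..<n}" "E - {a} - {b} \<subseteq> {1..k}"
            using Suc.prems(1-3) by blast+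
          show "0 < r" using False by simp
          show "card (E - {a} - {b}) \<le> r"
            using Suc.prems(5,7) b fin by simp
          show "\<forall>y\<in>?A. \<forall>j\<in>P - {q} - {i}. y ! j \<in> E - {a} - {b}"
            using img2 by blast
          show "\<forall>y\<in>?A. \<forall>z\<in>?A. \<forall>j\<in>{..<n} - (P - {q} - {i}). y ! j = z ! j"
          proof (intro ballI)
            fix y z j assume y: "y \<in> ?A" and z: "z \<in> ?A" and "j \<in> {..<n} - (P - {q} - {i})"
            then consider "j < n" "j \<notin> P" | "j = q" | "j = i" by blast
            then show "y ! j = z ! j"
              by cases (use off[OF y z] yq[OF y] yq[OF z] yi[OF y] yi[OF z] in simp_all)
          qed
        qed
      next
        \<comment> \<open>Only \<open>a\<close> was located, but \<open>(b, i)\<close> is a new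
          excluded pair.\<close>
        case nb: False
        show ?thesis
        proof (rule Suc.IH[of _ "P - {q}" "E - {a}" b i])
          show "?A \<subseteq> codes k n" "P - {q} \<subseteq> {..<n}" "E - {a} \<subseteq> {1..k}"
            using Suc.prems(1-3) by blast+
          show "0 < r" using False by simp
          show "card (P - {q}) = Suc r" "card (E - {a}) = Suc r"
            using Suc.prems(4,5,7) q fin by auto
          show "b \<in> E - {a}" "i \<in> P - {q}"
            using b qi Suc.prems(8) by auto
          show "\<forall>y\<in>?A. (!) y ` (P - {q}) = E - {a} \<and> y ! i \<noteq> b"
          proof
            fix y assume y: "y \<in> ?A"
            have "x ! i = b" using i by (simp add: x_def)
            then show "(!) y ` (P - {q}) = E - {a} \<and> y ! i \<noteq> b"
              using img[OF y] same[OF y i] nb by simp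
          qed
          show "\<forall>y\<in>?A. \<forall>z\<in>?A. \<forall>j\<in>{..<n} - (P - {q}). y ! j = z ! j"
          proof (intro ballI)
            fix y z j assume y: "y \<in> ?A" and z: "z \<in> ?A" and "j \<in> {..<n} - (P - {q})"
            then consider "j < n" "j \<notin> P" | "j = q" by blast
            then show "y ! j = z ! j"
              by cases (use off[OF y z] yq[OF y] yq[OF z] in simp_all)
          qed
        qed
      qed
    qed
    then show ?thesis using x(1) by auto
  qed
qed

section \<open>Opening guesses that use every code once\<close>

text \<open>Non-adaptive guesses split \<open>A\<close> into classes of equal feedback, and it
  suffices to win from each class. The induction plays the guess of largest index first.\<close>

lemma winnable_fixed_guesses:
  assumes "\<forall>j<c. g j \<in> codes k n"
    and "\<And>B. B \<subseteq> A \<Longrightarrow> \<forall>y\<in>B. \<forall>z\<in>B. \<forall>j<c. feedback (g j) y = feedback (g j) z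
      \<Longrightarrow> winnable k n r B"
  shows "winnable k n (c + r) A"
  using assms
proof (induction c arbitrary: A)
  case 0
  then show ?case by simp
next
  case (Suc c)
  have "winnable k n (c + r) {y \<in> A. feedback (g c) y = f \<and> y \<noteq> g c}" (is "winnable k n _ ?A") for f
  proof (rule Suc.IH)
    show "\<forall>j<c. g j \<in> codes k n" using Suc.prems(1) by auto
    fix B assume B: "B \<subseteq> ?A" "\<forall>y\<in>B. \<forall>z\<in>B. \<forall>j<c. feedback (g j) y = feedback (g j) z"
    show "winnable k n r B"
    proof (rule Suc.prems(2))
      show "B \<subseteq> A" using B(1) by blast
      have "feedback (g c) y = f" if "y \<in> B" for y
        using B(1) that by blast
      then show "\<forall>y\<in>B. \<forall>z\<in>B. \<forall>j<Suc c. feedback (g j) y = feedback (g j) z"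
        using B(2) less_Suc_eq by metis
    qed
  qed
  then show ?case using Suc.prems(1) by auto
qed

definition block :: "nat \<Rightarrow> nat \<Rightarrow> nat list" where
  "block n j = map (\<lambda>i. Suc (j * n + i)) [0..<n]"

lemma length_block [simp]: "length (block n j) = n"
  by (simp add: block_def)

lemma distinct_block: "distinct (block n j)"
  by (simp add: block_def distinct_map inj_on_def)

lemma block_in_codes:
  assumes "j < c"
  shows "block n j \<in> codes (c * n) n"
proof -
  have "(j + 1) * n \<le> c * n"
    using assms by (intro mult_right_mono) auto
  then show ?thesis
    by (auto simp: codes_def block_def)
qed

text \<open>The blocks partition the codes; the shift by 1 is due to codes starting at 1.\<close>

lemma block_nth_div_mod:
  assumes "a \<in> {1..c * n}"
  shows "(a - 1) div n < c" "(a - 1) mod n < n" "block n ((a - 1) div n) ! ((a - 1) mod n) = a"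
proof -
  have n: "n > 0" using assms by (cases n) auto
  show "(a - 1) div n < c"
    using assms n by (intro less_mult_imp_div_less) auto
  show "(a - 1) mod n < n" using n by simp
  then show "block n ((a - 1) div n) ! ((a - 1) mod n) = a"
    using assms by (simp add: block_def)
qed

text \<open>The blocks reveal the set \<open>E\<close> of occurring codes and, for each code,
  whether it sits where its block put it. Each possible outcome gains one round over the
  \<open>n\<close> rounds of constant guesses.\<close>

lemma winnable_after_blocks:
  assumes "n \<ge> 2" "c \<ge> 1" "B \<subseteq> codes (c * n) n"
    and same: "\<forall>y\<in>B. \<forall>z\<in>B. \<forall>j<c. feedback (block n j) y = feedback (block n j) z"
  shows "winnable (c * n) n (n - 1) B"
proof (cases "B = {}")
  case True
  then show ?thesis using winnable_empty[of "c * n"] assms(1,2) by simp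
next
  case False
  then obtain y0 where y0: "y0 \<in> B" by blast
  have len: "length y = n" and sub: "set y \<subseteq> {1..c * n}" if "y \<in> B" for y
    using assms(3) that by (auto simp: codes_def)
  have k: "c * n > 0" using assms(1,2) by simp
  have same_code: "(a \<in> set y \<longleftrightarrow> a \<in> set y0) \<and>
      (y ! ((a - 1) mod n) = a \<longleftrightarrow> y0 ! ((a - 1) mod n) = a)"
    if "y \<in> B" "a \<in> {1..c * n}" for y a
  proof -
    let ?x = "block n ((a - 1) div n)" and ?i = "(a - 1) mod n"
    note a = block_nth_div_mod[OF that(2)]
    have fb: "feedback ?x y = feedback ?x y0"
      using same that(1) y0 a(1) by blast
    have "feedback ?x z ! ?i = Black \<longleftrightarrow> a \<notin> set z" "feedback ?x z ! ?i = Green \<longleftrightarrow> z ! ?i = a"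
      if "z \<in> B" for z
      using feedback_nth_Black_iff[OF length_block len[OF that] a(2) distinct_block]
        feedback_nth_Green_iff[OF length_block len[OF that] a(2)] a(3) by auto
    from this[OF that(1)] this[OF y0] fb show ?thesis by auto
  qed
  define E where "E = set y0"
  have set_eq: "set y = E" if "y \<in> B" for y
    using same_code[OF that] sub[OF that] sub[OF y0] unfolding E_def by blast
  have E: "E \<subseteq> {1..c * n}" "finite E" "card E \<le> n"
    using sub[OF y0] card_length[of y0] len[OF y0] by (auto simp: E_def)
  have nth_E: "y ! i \<in> E" if "y \<in> B" "i < n" for y i
    using set_eq[OF that(1)] len[OF that(1)] that(2) nth_mem[of i y] by auto
  show ?thesis
  proof (cases "card E = n")
    case False
    show ?thesis
    proof (rule winnable_constant_guesses[OF k assms(3), of "{..<n}" E])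
      show "card E \<le> n - 1" using False E(3) by simp
      show "n - 1 > 0" using assms(1) by simp
    qed (use E nth_E in auto)
  next
    case True
    have dist: "distinct y" if "y \<in> B" for y
      using set_eq[OF that] len[OF that] True by (intro card_distinct) simp
    have img: "(!) y ` {..<n} = E" if "y \<in> B" for y
      using set_eq[OF that] len[OF that] by (auto simp: set_conv_nth)
    \<comment> \<open>Any occurring code would serve; \<open>i\<close> is the position at which its
      block tested it.\<close>
    define a where "a = y0 ! 0"
    define i where "i = (a - 1) mod n"
    have a: "a \<in> E" "a \<in> {1..c * n}"
      using nth_E[OF y0, of 0] E(1) assms(1) by (auto simp: a_def)
    have i: "i < n" using assms(1) by (simp add: i_def)
    show ?thesis
    proof (cases "y0 ! i = a")
      \<comment> \<open>The code \<open>a\<close> is settled, which leaves \<open>n - 1\<close>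
        codes.\<close>
      case True
      then have yi: "y ! i = a" if "y \<in> B" for y
        using same_code[OF that a(2)] by (simp add: i_def)
      show ?thesis
      proof (rule winnable_constant_guesses[OF k assms(3), of "{..<n} - {i}" "E - {a}"])
        show "card (E - {a}) \<le> n - 1" using a E \<open>card E = n\<close> by simp
        show "n - 1 > 0" using assms(1) by simp
        show "\<forall>y\<in>B. \<forall>j\<in>{..<n} - {i}. y ! j \<in> E - {a}"
        proof (intro ballI)
          fix y j assume y: "y \<in> B" and j: "j \<in> {..<n} - {i}"
          then have "y ! j \<noteq> y ! i"
            using dist[OF y] len[OF y] i by (simp add: nth_eq_iff_index_eq)
          then show "y ! j \<in> E - {a}" using nth_E[OF y] yi[OF y] j by simp
        qed
        show "\<forall>y\<in>B. \<forall>z\<in>B. \<forall>j\<in>{..<n} - ({..<n} - {i}). y ! j = z ! j"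
          using yi by auto
      qed (use E in auto)
    next
      case False
      then have "y ! i \<noteq> a" if "y \<in> B" for y
        using same_code[OF that a(2)] by (simp add: i_def)
      then show ?thesis
        using img E(1) a(1) i True assms(1)
        by (intro winnable_excluded_pair[OF k assms(3), of "{..<n}" E _ a i]) auto
    qed
  qed
qed

lemma winnable_codes:
  assumes "n \<ge> 1" "c \<ge> 1"
  shows "winnable (c * n) n (c + n - 1) (codes (c * n) n)"
proof (cases "n = 1")
  \<comment> \<open>For \<open>n = 1\<close> no round remains after the blocks to name the answer,
    so all \<open>c\<close> codes are treated by constant guesses.\<close>
  case True
  show ?thesis
  proof (rule winnable_constant_guesses[of _ _ _ "{..<n}" "{1..c * n}"])
    show "\<forall>y\<in>codes (c * n) n. \<forall>i\<in>{..<n}. y ! i \<in> {1..c * n}"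
      using nth_mem by (fastforce simp: codes_def)
  qed (use assms True in simp_all)
next
  case False
  have "winnable (c * n) n (c + (n - 1)) (codes (c * n) n)"
  proof (rule winnable_fixed_guesses)
    show "\<forall>j<c. block n j \<in> codes (c * n) n" using block_in_codes by blast
    show "winnable (c * n) n (n - 1) B"
      if "B \<subseteq> codes (c * n) n"
        "\<forall>y\<in>B. \<forall>z\<in>B. \<forall>j<c. feedback (block n j) y = feedback (block n j) z" for B
      using winnable_after_blocks[OF _ assms(2) that] assms(1) False by simp
  qed
  then show ?thesis using assms(1) by simp
qed

section \<open>Lower bound\<close>

text \<open>One move of the adversary against the guess \<open>x\<close>: \<open>z\<close> is an
  admissible rearrangement with fewest greens, and \<open>Q\<close> consists of the positions from
  which no green one can be reached. Closure under reachability confines the remaining options on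
  \<open>Q\<close> to the codes that \<open>z\<close> places there.\<close>

lemma fewest_greens_step:
  fixes x y :: "'a \<Rightarrow> 'b"
  assumes "finite P" "P \<noteq> {}" "inj_on y P"
    and S: "\<And>i. i \<in> P \<Longrightarrow> y i \<in> S i \<and> S i \<subseteq> y ` P \<and> S i - {x i} \<noteq> {}"
  shows "\<exists>z Q. Q \<subseteq> P \<and> Q \<noteq> {} \<and> (\<forall>i. i \<notin> P \<longrightarrow> z i = y i) \<and> z ` P = y ` P \<and>
    (\<forall>i\<in>P. z i \<in> S i) \<and> (\<forall>i\<in>Q. z i \<noteq> x i \<and> S i - {x i} \<subseteq> z ` Q)"
proof -
  define adm where "adm z \<longleftrightarrow>
    (\<forall>i. i \<notin> P \<longrightarrow> z i = y i) \<and> z ` P = y ` P \<and> (\<forall>i\<in>P. z i \<in> S i)" for z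
  define green where "green z = {i \<in> P. z i = x i}" for z
  have "adm y" using S by (simp add: adm_def)
  then obtain z where z: "adm z" and z_min: "\<And>z'. adm z' \<Longrightarrow> card (green z) \<le> card (green z')"
    using ex_has_least_nat[of adm y "\<lambda>z. card (green z)"] by blast
  \<comment> \<open>An edge from \<open>i\<close> to \<open>j\<close>: the code at \<open>j\<close>
    may move to \<open>i\<close> without becoming green.\<close>
  define D where "D = {(i, j). i \<in> P \<and> j \<in> P \<and> z j \<in> S i - {x i}}"
  define Q where "Q = {i \<in> P. \<forall>g\<in>green z. (i, g) \<notin> D\<^sup>*}"
  have succ: "\<exists>j. (i, j) \<in> D \<and> z j = d" if "i \<in> P" "d \<in> S i - {x i}" for i d
  proof -
    have "d \<in> z ` P" using that S z by (auto simp: adm_def)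
    then show ?thesis using that by (auto simp: D_def)
  qed
  have "Q \<noteq> {}"
  proof
    assume Q: "Q = {}"
    \<comment> \<open>Distance to the nearest green position. Choosing successors \<open>h\<close>
      that decrease it forces every cycle of \<open>h\<close> through a green position.\<close>
    define rank where "rank i = (LEAST m. \<exists>g\<in>green z. (i, g) \<in> D ^^ m)" for i
    have "\<exists>j. (i, j) \<in> D \<and> (i \<notin> green z \<longrightarrow> rank j < rank i)" if i: "i \<in> P" for i
    proof (cases "i \<in> green z")
      case True
      then show ?thesis using succ[OF i] S[OF i] by blast
    next
      case False
      obtain g where "g \<in> green z" "(i, g) \<in> D\<^sup>*"
        using Q i by (auto simp: Q_def)
      then have "\<exists>m. \<exists>g\<in>green z. (i, g) \<in> D ^^ m"
        using rtrancl_imp_relpow by metis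
      then have "\<exists>g\<in>green z. (i, g) \<in> D ^^ rank i"
        unfolding rank_def by (rule LeastI_ex)
      then obtain g where g: "g \<in> green z" "(i, g) \<in> D ^^ rank i" by blast
      with False obtain m where m: "rank i = Suc m" by (cases "rank i") auto
      with g obtain j where j: "(i, j) \<in> D" "(j, g) \<in> D ^^ m"
        by (metis relpow_Suc_E2)
      then have "rank j \<le> m"
        unfolding rank_def using g(1) by (blast intro: Least_le)
      then show ?thesis using j m by auto
    qed
    then obtain h where h: "\<And>i. i \<in> P \<Longrightarrow> (i, h i) \<in> D"
      "\<And>i. i \<in> P \<Longrightarrow> i \<notin> green z \<Longrightarrow> rank (h i) < rank i"
      by metis
    \<comment> \<open>A smallest nonempty set closed under \<open>h\<close> is permuted by
      \<open>h\<close>; its member of least rank must be green.\<close>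
    define inv where "inv Z \<longleftrightarrow> Z \<noteq> {} \<and> Z \<subseteq> P \<and> h ` Z \<subseteq> Z" for Z
    have "inv P" using assms(2) h(1) by (auto simp: inv_def D_def)
    then obtain Z where Z: "inv Z" and Z_min: "\<And>Z'. inv Z' \<Longrightarrow> card Z \<le> card Z'"
      using ex_has_least_nat[of inv P card] by blast
    have finZ: "finite Z" using Z assms(1) finite_subset by (auto simp: inv_def)
    have "inv (h ` Z)" using Z by (auto simp: inv_def)
    then have hZ: "h ` Z = Z"
      using Z_min[of "h ` Z"] Z finZ by (auto simp: inv_def card_seteq)
    obtain g where g: "g \<in> Z" "\<And>i. i \<in> Z \<Longrightarrow> rank g \<le> rank i"
      using ex_has_least_nat[of "\<lambda>i. i \<in> Z" _ rank] Z unfolding inv_def by blast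
    have "g \<in> green z"
    proof (rule ccontr)
      assume "g \<notin> green z"
      then have "rank (h g) < rank g" using h(2) g(1) Z by (auto simp: inv_def)
      then show False using g(1) g(2)[of "h g"] hZ by auto
    qed
    \<comment> \<open>Codes move along \<open>h\<close> within \<open>Z\<close>. Edges of
      \<open>D\<close> never create a green, and \<open>g\<close> ceases to be one, contradicting
      minimality.\<close>
    define z' where "z' i = (if i \<in> Z then z (h i) else z i)" for i
    have ZP: "Z \<subseteq> P" using Z by (simp add: inv_def)
    have "z' ` P = z' ` Z \<union> z' ` (P - Z)" using ZP by blast
    also have "z' ` Z = z ` Z" using hZ by (auto simp: z'_def image_iff) (metis imageE)
    also have "z' ` (P - Z) = z ` (P - Z)" by (auto simp: z'_def)
    also have "z ` Z \<union> z ` (P - Z) = y ` P"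
      using ZP z by (simp add: adm_def image_Un[symmetric] Un_absorb1)
    finally have "adm z'"
      using z ZP h(1) by (auto simp: adm_def z'_def D_def)
    moreover have "green z' \<subseteq> green z - {g}"
      using h(1) g(1) ZP by (auto simp: green_def z'_def D_def split: if_splits)
    then have "card (green z') < card (green z)"
      using \<open>g \<in> green z\<close> assms(1) by (intro psubset_card_mono) (auto simp: green_def)
    ultimately show False using z_min[of z'] by simp
  qed
  moreover have "z i \<noteq> x i" if "i \<in> Q" for i
    using that by (auto simp: Q_def green_def)
  moreover have "S i - {x i} \<subseteq> z ` Q" if i: "i \<in> Q" for i
  proof
    fix d assume d: "d \<in> S i - {x i}"
    have "i \<in> P" using i by (simp add: Q_def)
    from succ[OF this d] obtain j where j: "(i, j) \<in> D" "z j = d" by blast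
    \<comment> \<open>A green position reachable from \<open>j\<close> would be reachable from
      \<open>i\<close>.\<close>
    then have "j \<in> Q"
      using i by (auto simp: Q_def D_def intro: converse_rtrancl_into_rtrancl)
    then show "d \<in> z ` Q" using j by blast
  qed
  ultimately show ?thesis
    using z by (intro exI[of _ z] exI[of _ Q]) (auto simp: adm_def Q_def)
qed

section \<open>The adversary's invariant\<close>

text \<open>For \<open>y\<close> injective on a finite \<open>P\<close>, these are the perfect
  matchings of \<open>P\<close> with its image under \<open>y\<close> that respect \<open>S\<close>,
  completed by \<open>y\<close> outside \<open>P\<close>.\<close>

definition candidates ::
    "nat \<Rightarrow> nat set \<Rightarrow> (nat \<Rightarrow> nat) \<Rightarrow> (nat \<Rightarrow> nat set) \<Rightarrow> nat list set" where
  "candidates n P y S = {map z [0..<n] | z.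
     (\<forall>i. i \<notin> P \<longrightarrow> z i = y i) \<and> z ` P = y ` P \<and> (\<forall>i\<in>P. z i \<in> S i)}"

lemma mset_map_upt_cong:
  assumes "P \<subseteq> {..<n}" "inj_on y P" "\<forall>i. i \<notin> P \<longrightarrow> z i = y i" "z ` P = y ` P"
  shows "mset (map z [0..<n]) = mset (map y [0..<n])"
proof -
  have fin: "finite P" using assms(1) finite_subset by blast
  have inj: "inj_on z P"
    using assms(2,4) fin by (metis card_image eq_card_imp_inj_on)
  have upt: "mset_set {0..<n} = mset_set P + mset_set ({..<n} - P)"
    using assms(1) fin by (subst mset_set_Union[symmetric]) (auto intro: arg_cong[where f = mset_set])
  have "image_mset z (mset_set P) = image_mset y (mset_set P)"
    using image_mset_mset_set[OF inj] image_mset_mset_set[OF assms(2)] assms(4) by simp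
  moreover have "image_mset z (mset_set ({..<n} - P)) = image_mset y (mset_set ({..<n} - P))"
    using assms(3) by (intro image_mset_cong) auto
  ultimately show ?thesis by (simp add: upt)
qed

text \<open>Each round shrinks \<open>P\<close> to some \<open>Q\<close> and costs each remaining
  position at most the guessed code, so more than \<open>r\<close> options per position survive
  \<open>r\<close> rounds; the current \<open>y\<close> is then itself an unfound answer.\<close>

lemma not_winnable_candidates:
  assumes "P \<subseteq> {..<n}" "P \<noteq> {}" "inj_on y P" "candidates n P y S \<subseteq> A"
    and "\<forall>i\<in>P. y i \<in> S i \<and> S i \<subseteq> y ` P \<and> card (S i) > r"
  shows "\<not> winnable k n r A"
  using assms
proof (induction r arbitrary: P y S A)
  case 0
  have "map y [0..<n] \<in> A"
    using 0 by (auto simp: candidates_def)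
  then show ?case by auto
next
  case (Suc r)
  have fin: "finite P" using Suc.prems(1) finite_subset by blast
  have "\<exists>f. \<not> winnable k n r {w \<in> A. feedback x w = f \<and> w \<noteq> x}" if "x \<in> codes k n" for x
  proof -
    have x: "length x = n" using that by (simp add: codes_def)
    have card: "card (S i - {x ! i}) > r" if "i \<in> P" for i
      using Suc.prems(5) that by (auto simp: card_Diff_singleton_if)
    then have "S i - {x ! i} \<noteq> {}" if "i \<in> P" for i
      using that by (metis card.empty not_less_zero)
    then obtain z Q where Q: "Q \<subseteq> P" "Q \<noteq> {}" and z: "\<forall>i. i \<notin> P \<longrightarrow> z i = y i" "z ` P = y ` P"
      "\<forall>i\<in>P. z i \<in> S i" "\<forall>i\<in>Q. z i \<noteq> x ! i \<and> S i - {x ! i} \<subseteq> z ` Q"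
      using fewest_greens_step[OF fin Suc.prems(2,3), of S "(!) x"] Suc.prems(5) by metis
    have inj: "inj_on z P"
      using Suc.prems(3) z(2) fin by (metis card_image eq_card_imp_inj_on)
    have injQ: "inj_on z Q"
      using inj Q(1) by (rule inj_on_subset)
    let ?S = "\<lambda>i. S i - {x ! i}"
    \<comment> \<open>The adversary replies as if the answer were \<open>z\<close>.\<close>
    have "\<not> winnable k n r {w \<in> A. feedback x w = feedback x (map z [0..<n]) \<and> w \<noteq> x}"
    proof (rule Suc.IH[of Q z ?S])
      show "Q \<subseteq> {..<n}" "Q \<noteq> {}" "inj_on z Q"
        using Q Suc.prems(1) injQ by auto
      show "\<forall>i\<in>Q. z i \<in> ?S i \<and> ?S i \<subseteq> z ` Q \<and> r < card (?S i)"
        using z Q card by blast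
      show "candidates n Q z ?S \<subseteq> {w \<in> A. feedback x w = feedback x (map z [0..<n]) \<and> w \<noteq> x}"
      proof
        fix w assume "w \<in> candidates n Q z ?S"
        then obtain u where w: "w = map u [0..<n]" and u: "\<forall>i. i \<notin> Q \<longrightarrow> u i = z i"
          "u ` Q = z ` Q" "\<forall>i\<in>Q. u i \<in> ?S i"
          by (auto simp: candidates_def)
        have "u ` P = u ` Q \<union> u ` (P - Q)" using Q(1) by blast
        also have "u ` (P - Q) = z ` (P - Q)" using u(1) by auto
        also have "u ` Q \<union> z ` (P - Q) = z ` P" using Q(1) u(2) by auto
        finally have "u ` P = y ` P" using z(2) by simp
        moreover have "\<forall>i. i \<notin> P \<longrightarrow> u i = y i" using u(1) z(1) Q(1) by auto
        moreover have "\<forall>i\<in>P. u i \<in> S i" using u(1,3) z(3) by (metis DiffD1)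
        ultimately have "w \<in> A"
          using Suc.prems(4) w by (auto simp: candidates_def)
        moreover have "feedback x w = feedback x (map z [0..<n])"
        proof (rule feedback_cong[OF x])
          show "mset w = mset (map z [0..<n])"
            unfolding w using Q(1) Suc.prems(1) u(1,2)
            by (intro mset_map_upt_cong[OF _ injQ]) auto
          \<comment> \<open>On \<open>Q\<close> neither is green; elsewhere they coincide.\<close>
          have "x ! i = u i \<longleftrightarrow> x ! i = z i" for i
            using u(1,3) z(4) by (cases "i \<in> Q") auto
          then show "\<forall>i<n. (x ! i = w ! i) = (x ! i = map z [0..<n] ! i)"
            by (simp add: w)
        qed (simp_all add: w)
        moreover have "w \<noteq> x"
        proof
          assume "w = x"
          obtain i where i: "i \<in> Q" using Q by blast
          then have "w ! i = u i" using Q(1) Suc.prems(1) by (auto simp: w)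
          then show False using u(3) i \<open>w = x\<close> by auto
        qed
        ultimately show "w \<in> {w \<in> A. feedback x w = feedback x (map z [0..<n]) \<and> w \<noteq> x}"
          by simp
      qed
    qed
    then show ?thesis by blast
  qed
  then show ?case by auto
qed

text \<open>An all-black reply uses up at most \<open>n\<close> codes of \<open>V\<close>. After
  \<open>j\<close> such replies \<open>n\<close> codes remain, and their permutations resist
  \<open>n - 1\<close> further rounds.\<close>

lemma not_winnable_unused_codes:
  assumes "n \<ge> 1" "V \<subseteq> {1..k}" "card V \<ge> n + j * n" "{y. length y = n \<and> set y \<subseteq> V} \<subseteq> A"
  shows "\<not> winnable k n (n - 1 + j) A"
  using assms(2-4)
proof (induction j arbitrary: V A)
  case 0
  have "n \<le> card V" using 0(2) by simp
  then obtain T where T: "T \<subseteq> V" "card T = n" "finite T"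
    by (rule obtain_subset_with_card_n)
  then obtain y where y: "bij_betw y {..<n} T"
    using ex_bij_betw_nat_finite[of T] by (auto simp: atLeast0LessThan)
  \<comment> \<open>Initially every position is undecided and admits all \<open>n\<close> codes of
    \<open>T\<close>, one more than the rounds left.\<close>
  have "candidates n {..<n} y (\<lambda>_. T) \<subseteq> A"
  proof
    fix w assume "w \<in> candidates n {..<n} y (\<lambda>_. T)"
    then have "length w = n" "set w \<subseteq> T" by (auto simp: candidates_def)
    then show "w \<in> A" using 0(3) T(1) by auto
  qed
  moreover have "\<forall>i\<in>{..<n}. y i \<in> T \<and> T \<subseteq> y ` {..<n} \<and> card T > n - 1 + 0"
    using y T assms(1) by (auto simp: bij_betw_def)
  ultimately show ?case
    using y assms(1) not_winnable_candidates[of "{..<n}" n y "\<lambda>_. T" A "n - 1 + 0" k]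
    by (auto simp: bij_betw_def lessThan_empty_iff)
next
  case (Suc j)
  have "\<exists>f. \<not> winnable k n (n - 1 + j) {y \<in> A. feedback x y = f \<and> y \<noteq> x}" if "x \<in> codes k n" for x
  proof -
    have x: "length x = n" using that by (simp add: codes_def)
    have "\<not> winnable k n (n - 1 + j) {y \<in> A. feedback x y = replicate n Black \<and> y \<noteq> x}"
    proof (rule Suc.IH[of "V - set x"])
      show "V - set x \<subseteq> {1..k}" using Suc.prems(1) by auto
      have "card V - card (set x) \<le> card (V - set x)"
        by (rule diff_card_le_card_Diff) simp
      then show "n + j * n \<le> card (V - set x)"
        using Suc.prems(2) card_length[of x] x by simp
      show "{y. length y = n \<and> set y \<subseteq> V - set x}
          \<subseteq> {y \<in> A. feedback x y = replicate n Black \<and> y \<noteq> x}"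
      proof
        fix y assume "y \<in> {y. length y = n \<and> set y \<subseteq> V - set x}"
        then have y: "length y = n" "set y \<subseteq> V" "set x \<inter> set y = {}" by auto
        moreover have "y \<noteq> x"
        proof
          assume "y = x"
          then have "y = []" using y(3) by simp
          then show False using y(1) assms(1) by simp
        qed
        ultimately show "y \<in> {y \<in> A. feedback x y = replicate n Black \<and> y \<noteq> x}"
          using feedback_disjoint[OF x] Suc.prems(3) by auto
      qed
    qed
    then show ?thesis by blast
  qed
  then show ?case by auto
qed

theorem theorem2:
  fixes n c k :: nat
  assumes "n \<ge> 1" and "c \<ge> 1" and "k = c * n"
  shows "F k n = c + n - 1"
proof -
  have k: "k > 0" using assms by simp
  have "\<not> winnable k n (n - 1 + (c - 1)) (codes k n)"
    using assms not_winnable_unused_codes[of n "{1..k}" k "c - 1" "codes k n"]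
    by (simp add: codes_def algebra_simps)
  have lower: "\<not> solves_within k n (c + n - 2) s" for s
  proof -
    have "n - 1 + (c - 1) = c + n - 2" using assms(1,2) by simp
    with \<open>\<not> winnable k n (n - 1 + (c - 1)) (codes k n)\<close> show ?thesis
      using ex_solves_within_iff[OF k, of n "c + n - 2"] by metis
  qed
  \<comment> \<open>Extra rounds never hurt, so refuting \<open>c + n - 2\<close> rounds refutes
    every smaller number.\<close>
  have "c + n - 1 \<le> m" if "\<exists>s. solves_within k n m s" for m
  proof (rule ccontr)
    assume "\<not> c + n - 1 \<le> m"
    then have "m \<le> c + n - 2" by simp
    then have "\<exists>s. solves_within k n (c + n - 2) s"
      using that unfolding solves_within_def by (meson less_le_trans)
    then show False using lower by blast
  qed
  moreover have "\<exists>s. solves_within k n (c + n - 1) s"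
    using winnable_codes ex_solves_within_iff[OF k] assms by simp
  ultimately show ?thesis
    unfolding F_def by (intro Least_equality)
qed

end
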